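(* Let $A$ be an invertible $n\times n$ matrix over a commutative ring of characteristic two, and put $B=A^{-1}$, $\Delta=\det A$, $F=\Phi(A)$. Let $C$ be the $n\times n$ matrix with entries $C_{p,j}=A_{p,j}^2B_{j,p}$. Then $$\mathcal G(A)=\Delta\,BCB+(F+\Delta)B.$$ Once $F,B,\Delta$ are known, computing $\mathcal G(A)$ in this way costs two matrix multiplications and $O(n^2)$ additional operations.
   Context: For an $n\times n$ matrix $A$ over a commutative ring of characteristic two, $$\Phi(A)=\sum_{\pi\in S_n,\ \pi\text{ odd}}\ \prod_{i=1}^n A_{i,\pi(i)}$$ (sum over permutations that are odd in the usual sense; $\Phi(A)=0$ for orders $0$ and $1$), and $\mathcal G(A)$ is the $n\times n$ matrix with $\mathcal G(A)_{j,i}=\frac{\partial\Phi}{\partial A_{i,j}}(A)$, the formal partial derivatives of the polynomial $\Phi$ in the $n^2$ entries evaluated at $A$. A matrix over a commutative ring is invertible if it has an inverse over that ring. Operations are arithmetic operations in the ring. *)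

theory Defs
  imports
    "Jordan_Normal_Form.Determinant"
    "HOL-Library.Poly_Mapping"
    "HOL-Library.Landau_Symbols"
begin

section \<open>The sum over odd permutations\<close>

definition Phi :: "'a :: comm_semiring_1 mat \<Rightarrow> 'a" where
  "Phi A = (\<Sum>p | p permutes {0..<dim_row A} \<and> \<not> evenperm p.
              \<Prod>i = 0..<dim_row A. A $$ (i, p i))"

section \<open>Formal polynomials and their partial derivatives\<close>

text \<open>
  A polynomial in indeterminates from \<open>'v\<close> is a finitely supported map from monomials
  to coefficients; a monomial is the finitely supported map giving the exponents.
\<close>

type_synonym ('v, 'a) mpoly = "('v \<Rightarrow>\<^sub>0 nat) \<Rightarrow>\<^sub>0 'a"

definition mvar :: "'v \<Rightarrow> ('v, 'a :: comm_semiring_1) mpoly" where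
  "mvar v = Poly_Mapping.single (Poly_Mapping.single v 1) 1"

definition mpoly_eval :: "('v \<Rightarrow> 'a) \<Rightarrow> ('v, 'a :: comm_semiring_1) mpoly \<Rightarrow> 'a" where
  "mpoly_eval f p = (\<Sum>m\<in>Poly_Mapping.keys p. Poly_Mapping.lookup p m *
                       (\<Prod>v\<in>Poly_Mapping.keys m. f v ^ Poly_Mapping.lookup m v))"

text \<open>
  Monomials in which \<open>v\<close> does not occur get the coefficient \<open>0\<close>, so the truncated
  subtraction of exponents is harmless.
\<close>

definition mpoly_pderiv :: "'v \<Rightarrow> ('v, 'a :: comm_semiring_1) mpoly \<Rightarrow> ('v, 'a) mpoly" where
  "mpoly_pderiv v p = (\<Sum>m\<in>Poly_Mapping.keys p.
     Poly_Mapping.single (m - Poly_Mapping.single v 1)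
       (of_nat (Poly_Mapping.lookup m v) * Poly_Mapping.lookup p m))"

text \<open>\<open>Phi\<close> as a polynomial: its value at the generic matrix with independent entries.\<close>

definition Phi_poly :: "nat \<Rightarrow> (nat \<times> nat, 'a :: comm_semiring_1) mpoly" where
  "Phi_poly n = Phi (mat n n (\<lambda>(i, j). mvar (i, j)))"

text \<open>Note the transposition: row \<open>j\<close>, column \<open>i\<close> holds the derivative in the entry \<open>(i, j)\<close>.\<close>

definition grad_Phi :: "'a :: comm_semiring_1 mat \<Rightarrow> 'a mat" where
  "grad_Phi A = mat (dim_row A) (dim_row A)
     (\<lambda>(j, i). mpoly_eval (\<lambda>k. A $$ k) (mpoly_pderiv (i, j) (Phi_poly (dim_row A))))"

section \<open>Straight-line programs with matrix multiplications\<close>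

text \<open>
  Registers are grouped into arrays: \<open>(X, i, j)\<close> is the cell \<open>(i, j)\<close> of the array \<open>X\<close>.
  For a program of order \<open>n\<close> the cells with \<open>i, j < n\<close> form the matrix stored in \<open>X\<close>;
  a scalar is stored in the cell \<open>(0, 0)\<close> of an array of its own.  A program is a list of
  instructions with the target as first argument.  It does not depend on the ring,
  whose elements occur only in the machine states.
\<close>

type_synonym 'x reg = "'x \<times> nat \<times> nat"

datatype 'x instr =
    Add "'x reg" "'x reg" "'x reg"
  | Sub "'x reg" "'x reg" "'x reg"
  | Mul "'x reg" "'x reg" "'x reg"
  | is_MatMul: MatMul 'x 'x 'x

definition stored_mat :: "nat \<Rightarrow> ('x reg \<Rightarrow> 'a) \<Rightarrow> 'x \<Rightarrow> 'a mat" where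
  "stored_mat n s X = mat n n (\<lambda>(i, j). s (X, i, j))"

fun exec :: "nat \<Rightarrow> 'x instr \<Rightarrow> ('x reg \<Rightarrow> 'a :: comm_ring_1) \<Rightarrow> ('x reg \<Rightarrow> 'a)" where
  "exec n (Add z x y) s = s(z := s x + s y)"
| "exec n (Sub z x y) s = s(z := s x - s y)"
| "exec n (Mul z x y) s = s(z := s x * s y)"
| "exec n (MatMul Z X Y) s =
     (\<lambda>(V, i, j). if V = Z \<and> i < n \<and> j < n
                  then (stored_mat n s X * stored_mat n s Y) $$ (i, j) else s (V, i, j))"

definition run :: "nat \<Rightarrow> 'x instr list \<Rightarrow> ('x reg \<Rightarrow> 'a :: comm_ring_1) \<Rightarrow> ('x reg \<Rightarrow> 'a)" where
  "run n P = fold (exec n) P"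

definition matmul_count :: "'x instr list \<Rightarrow> nat" where
  "matmul_count P = length (filter is_MatMul P)"

definition ring_op_count :: "'x instr list \<Rightarrow> nat" where
  "ring_op_count P = length (filter (\<lambda>c. \<not> is_MatMul c) P)"

section \<open>Evaluating the gradient formula\<close>

text \<open>
  \<open>InA\<close>, \<open>InB\<close>, \<open>InF\<close>, \<open>InDelta\<close> are the inputs; the other arrays need no initialisation.
\<close>

datatype arr = InA | InB | InF | InDelta | ArrC | ArrS | ArrT | Out

text \<open>
  The five parts compute, in order, \<open>C\<close>; then \<open>B C\<close>; then \<open>(B C) B\<close>; then \<open>F + \<Delta>\<close>;
  and finally, entry by entry, \<open>\<Delta> (B C B) + (F + \<Delta>) B\<close>.
\<close>

definition grad_program :: "nat \<Rightarrow> arr instr list" where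
  "grad_program n =
     concat [[Mul (ArrC, p, j) (InA, p, j) (InA, p, j),
              Mul (ArrC, p, j) (ArrC, p, j) (InB, j, p)]. p \<leftarrow> [0..<n], j \<leftarrow> [0..<n]]
   @ [MatMul ArrT InB ArrC]
   @ [MatMul Out ArrT InB]
   @ [Add (ArrS, 0, 0) (InF, 0, 0) (InDelta, 0, 0)]
   @ concat [[Mul (Out, i, j) (InDelta, 0, 0) (Out, i, j),
              Mul (ArrT, i, j) (ArrS, 0, 0) (InB, i, j),
              Add (Out, i, j) (Out, i, j) (ArrT, i, j)]. i \<leftarrow> [0..<n], j \<leftarrow> [0..<n]]"

end

theory Submission
  imports Defs
begin

text \<open>
  By linearity of \<open>\<Phi>\<close> in each row, the entry \<open>(q, p)\<close> of \<open>A \<G>(A)\<close> is \<open>\<Phi>\<close> of the matrix \<open>A\<close> with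
  row \<open>p\<close> replaced by row \<open>q\<close>.  On the diagonal this is \<open>F\<close>.  Off the diagonal the matrix has two
  equal rows, so each odd term may be traded for an even one; keeping those with
  \<open>\<pi> p < \<pi> q\<close> leaves \<open>\<Sum>\<^sub>a\<^sub><\<^sub>b A\<^sub>q\<^sub>a A\<^sub>q\<^sub>b m\<^sub>a\<^sub>b\<close>, where \<open>m\<^sub>a\<^sub>b\<close> is the complementary minor
  \<open>\<Delta> (B\<^sub>a\<^sub>p B\<^sub>b\<^sub>q + B\<^sub>a\<^sub>q B\<^sub>b\<^sub>p)\<close>.  The sum over all pairs \<open>(a, b)\<close> vanishes since \<open>(A B)\<^sub>q\<^sub>p = 0\<close>,
  and what remains are the diagonal terms \<open>\<Delta> (C B)\<^sub>q\<^sub>p\<close>.  As squaring is additive, \<open>C B\<close> has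
  unit diagonal; hence \<open>A \<G>(A) = \<Delta> C B + (F + \<Delta>) 1\<close>.
\<close>

section \<open>The entries of the gradient\<close>

text \<open>Monomials outside the support have coefficient 0. The free choice of \<open>S\<close>
  lets \<open>p\<close>, \<open>q\<close> and \<open>p + q\<close>, whose supports differ when
  coefficients cancel, be summed over one common set.\<close>

lemma mpoly_eval_superset:
  assumes "finite S" "Poly_Mapping.keys p \<subseteq> S"
  shows "mpoly_eval f p = (\<Sum>m\<in>S. Poly_Mapping.lookup p m *
    (\<Prod>v\<in>Poly_Mapping.keys m. f v ^ Poly_Mapping.lookup m v))"
  unfolding mpoly_eval_def
  by (rule sum.mono_neutral_left) (use assms in \<open>auto simp: not_in_keys_iff_lookup_eq_zero\<close>)

lemma mpoly_eval_zero [simp]: "mpoly_eval f 0 = 0"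
  by (simp add: mpoly_eval_def)

lemma mpoly_eval_add: "mpoly_eval f (p + q) = mpoly_eval f p + mpoly_eval f q"
proof -
  let ?S = "Poly_Mapping.keys p \<union> Poly_Mapping.keys q"
  note superset = mpoly_eval_superset[of ?S, simplified]
  show ?thesis
    using superset[of "p + q" f] superset[of p f] superset[of q f] Poly_Mapping.keys_add[of p q]
    by (simp add: lookup_add distrib_right sum.distrib)
qed

lemma mpoly_eval_sum: "mpoly_eval f (sum g I) = (\<Sum>i\<in>I. mpoly_eval f (g i))"
  by (induction I rule: infinite_finite_induct) (simp_all add: mpoly_eval_add)

lemma mpoly_eval_single:
  "mpoly_eval f (Poly_Mapping.single m c) =
    c * (\<Prod>v\<in>Poly_Mapping.keys m. f v ^ Poly_Mapping.lookup m v)"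
  by (simp add: mpoly_eval_def)

lemma mpoly_pderiv_superset:
  assumes "finite S" "Poly_Mapping.keys p \<subseteq> S"
  shows "mpoly_pderiv v p = (\<Sum>m\<in>S. Poly_Mapping.single (m - Poly_Mapping.single v 1)
    (of_nat (Poly_Mapping.lookup m v) * Poly_Mapping.lookup p m))"
  unfolding mpoly_pderiv_def
  by (rule sum.mono_neutral_left) (use assms in \<open>auto simp: not_in_keys_iff_lookup_eq_zero\<close>)

lemma mpoly_pderiv_zero [simp]: "mpoly_pderiv v 0 = 0"
  by (simp add: mpoly_pderiv_def)

lemma mpoly_pderiv_add: "mpoly_pderiv v (p + q) = mpoly_pderiv v p + mpoly_pderiv v q"
proof -
  let ?S = "Poly_Mapping.keys p \<union> Poly_Mapping.keys q"
  note superset = mpoly_pderiv_superset[of ?S, simplified]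
  show ?thesis
    using superset[of "p + q" v] superset[of p v] superset[of q v] Poly_Mapping.keys_add[of p q]
    by (simp add: lookup_add distrib_left single_add sum.distrib)
qed

lemma mpoly_pderiv_sum: "mpoly_pderiv v (sum g I) = (\<Sum>i\<in>I. mpoly_pderiv v (g i))"
  by (induction I rule: infinite_finite_induct) (simp_all add: mpoly_pderiv_add)

lemma mpoly_pderiv_single:
  "mpoly_pderiv v (Poly_Mapping.single m c) =
    Poly_Mapping.single (m - Poly_Mapping.single v 1) (of_nat (Poly_Mapping.lookup m v) * c)"
  by (simp add: mpoly_pderiv_def)

section \<open>Squarefree monomials\<close>

lemma prod_mvar:
  "(\<Prod>i\<in>I. mvar (v i)) = Poly_Mapping.single (\<Sum>i\<in>I. Poly_Mapping.single (v i) 1) 1"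
  by (induction I rule: infinite_finite_induct) (simp_all add: mvar_def mult_single)

text \<open>Injectivity of \<open>v\<close> makes the monomial squarefree, so no exponent exceeds
  1.\<close>

lemma lookup_sum_single:
  assumes "finite I" "inj_on v I"
  shows "Poly_Mapping.lookup (\<Sum>i\<in>I. Poly_Mapping.single (v i) (1 :: nat)) x =
    (if x \<in> v ` I then 1 else 0)"
proof -
  have "Poly_Mapping.lookup (\<Sum>i\<in>I. Poly_Mapping.single (v i) (1 :: nat)) x =
    (\<Sum>i\<in>I. if v i = x then 1 else 0)"
    by (simp add: lookup_sum lookup_single when_def del: One_nat_def)
  also have "\<dots> = (\<Sum>y\<in>v ` I. if y = x then 1 else 0)"
    by (simp add: sum.reindex[OF assms(2)])
  finally show ?thesis
    using assms(1) by simp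
qed

lemma mpoly_eval_prod_mvar:
  assumes "finite I" "inj_on v I"
  shows "mpoly_eval f (\<Prod>i\<in>I. mvar (v i)) = (\<Prod>i\<in>I. f (v i))"
proof -
  let ?m = "\<Sum>i\<in>I. Poly_Mapping.single (v i) (1 :: nat)"
  note lookup = lookup_sum_single[OF assms]
  have keys: "Poly_Mapping.keys ?m = v ` I"
    by (auto simp: in_keys_iff lookup simp del: One_nat_def split: if_splits)
  have "mpoly_eval f (\<Prod>i\<in>I. mvar (v i)) = (\<Prod>x\<in>v ` I. f x ^ Poly_Mapping.lookup ?m x)"
    by (simp add: prod_mvar mpoly_eval_single keys del: One_nat_def)
  also have "\<dots> = (\<Prod>x\<in>v ` I. f x)"
    by (rule prod.cong) (simp_all add: lookup del: One_nat_def)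
  finally show ?thesis
    by (simp add: prod.reindex[OF assms(2)])
qed

lemma mpoly_pderiv_prod_mvar:
  assumes "finite I" "inj_on v I" "i \<in> I"
  shows "mpoly_pderiv (v i) (\<Prod>k\<in>I. mvar (v k)) = (\<Prod>k\<in>I - {i}. mvar (v k))"
proof -
  let ?m = "\<lambda>J. \<Sum>k\<in>J. Poly_Mapping.single (v k) (1 :: nat)"
  \<comment> \<open>Once the summand of \<open>i\<close> is split off, the truncated subtraction of
    exponents cancels it exactly.\<close>
  have "?m I - Poly_Mapping.single (v i) 1 = ?m (I - {i})"
    using assms(1,3) by (simp add: sum.remove)
  moreover have "Poly_Mapping.lookup (?m I) (v i) = 1"
    using assms by (simp add: lookup_sum_single del: One_nat_def)
  ultimately show ?thesis
    by (simp add: prod_mvar mpoly_pderiv_single del: One_nat_def)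
qed

lemma mpoly_pderiv_prod_mvar_zero:
  assumes "finite I" "inj_on v I" "x \<notin> v ` I"
  shows "mpoly_pderiv x (\<Prod>k\<in>I. mvar (v k)) = 0"
  using assms by (simp add: prod_mvar mpoly_pderiv_single lookup_sum_single del: One_nat_def)

text \<open>The indeterminates \<open>(k, \<pi> k)\<close> in one term of \<Phi> lie in different
  rows, so every term is squarefree. Its derivative in the entry \<open>(i, j)\<close> drops the
  factor of row \<open>i\<close> if \<open>\<pi> i = j\<close> and vanishes otherwise.\<close>

lemma grad_Phi_entry:
  fixes A :: "'a :: comm_semiring_1 mat"
  assumes A: "A \<in> carrier_mat n n" and "i < n" "j < n"
  shows "grad_Phi A $$ (j, i) =
    (\<Sum>\<pi> | \<pi> permutes {0..<n} \<and> \<not> evenperm \<pi> \<and> \<pi> i = j. \<Prod>k\<in>{0..<n} - {i}. A $$ (k, \<pi> k))"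
proof -
  let ?odd = "{\<pi>. \<pi> permutes {0..<n} \<and> \<not> evenperm \<pi>}"
  have finite: "finite ?odd"
    by (simp add: finite_permutations)
  have inj: "inj_on (\<lambda>k. (k, \<pi> k)) I" for \<pi> :: "nat \<Rightarrow> nat" and I
    by (auto intro: inj_onI)
  have "Phi_poly n = (\<Sum>\<pi>\<in>?odd. \<Prod>k = 0..<n. mvar (k, \<pi> k) :: (nat \<times> nat, 'a) mpoly)"
  proof -
    \<comment> \<open>The entries of the generic matrix are known only within its bounds.\<close>
    have "\<pi> k < n" if "\<pi> permutes {0..<n}" "k < n" for \<pi> k
      using permutes_in_image[OF that(1), of k] that(2) by simp
    then show ?thesis
      unfolding Phi_poly_def Phi_def by simp
  qed
  then have "grad_Phi A $$ (j, i) =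
    (\<Sum>\<pi>\<in>?odd. mpoly_eval (($$) A) (mpoly_pderiv (i, j) (\<Prod>k = 0..<n. mvar (k, \<pi> k))))"
    using assms by (simp add: grad_Phi_def mpoly_pderiv_sum mpoly_eval_sum)
  also have "\<dots> = (\<Sum>\<pi>\<in>?odd. if \<pi> i = j then \<Prod>k\<in>{0..<n} - {i}. A $$ (k, \<pi> k) else 0)"
  proof (rule sum.cong)
    fix \<pi>
    show "mpoly_eval (($$) A) (mpoly_pderiv (i, j) (\<Prod>k = 0..<n. mvar (k, \<pi> k))) =
      (if \<pi> i = j then \<Prod>k\<in>{0..<n} - {i}. A $$ (k, \<pi> k) else 0)"
    proof (cases "\<pi> i = j")
      case True
      with \<open>i < n\<close> have "mpoly_pderiv (i, j) (\<Prod>k = 0..<n. mvar (k, \<pi> k)) =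
          (\<Prod>k\<in>{0..<n} - {i}. mvar (k, \<pi> k) :: (nat \<times> nat, 'a) mpoly)"
        using mpoly_pderiv_prod_mvar[OF _ inj, of "{0..<n}" i \<pi>] by simp
      with True show ?thesis
        by (simp add: mpoly_eval_prod_mvar inj)
    next
      case False
      then have "(i, j) \<notin> (\<lambda>k. (k, \<pi> k)) ` {0..<n}"
        by auto
      with False show ?thesis
        by (simp add: mpoly_pderiv_prod_mvar_zero inj)
    qed
  qed simp
  also have "\<dots> = (\<Sum>\<pi>\<in>{\<pi> \<in> ?odd. \<pi> i = j}. \<Prod>k\<in>{0..<n} - {i}. A $$ (k, \<pi> k))"
    by (rule sum.inter_filter[OF finite, symmetric])
  finally show ?thesis
    by (simp add: conj_assoc)
qed

text \<open>The sum over the column \<open>j\<close> in the matrix product collects the odd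
  permutations by their value \<open>\<pi> p = j\<close>. The result is \<Phi> of \<open>A\<close>
  with row \<open>p\<close> replaced by row \<open>q\<close>.\<close>

lemma mult_grad_Phi_entry:
  assumes A: "A \<in> carrier_mat n n" and q: "q < n" and p: "p < n"
  shows "(A * grad_Phi A) $$ (q, p) =
    (\<Sum>\<pi> | \<pi> permutes {0..<n} \<and> \<not> evenperm \<pi>.
      A $$ (q, \<pi> p) * (\<Prod>k\<in>{0..<n} - {p}. A $$ (k, \<pi> k)))"
proof -
  let ?odd = "{\<pi>. \<pi> permutes {0..<n} \<and> \<not> evenperm \<pi>}"
  have finite: "finite ?odd"
    by (simp add: finite_permutations)
  have image: "(\<lambda>\<pi>. \<pi> p) ` ?odd \<subseteq> {0..<n}"
    using p permutes_in_image by fastforce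
  have "(A * grad_Phi A) $$ (q, p) = (\<Sum>j = 0..<n. A $$ (q, j) * grad_Phi A $$ (j, p))"
    using A p q by (simp add: grad_Phi_def scalar_prod_def)
  also have "\<dots> = (\<Sum>j = 0..<n. \<Sum>\<pi>\<in>{\<pi> \<in> ?odd. \<pi> p = j}.
      A $$ (q, \<pi> p) * (\<Prod>k\<in>{0..<n} - {p}. A $$ (k, \<pi> k)))"
    using A p by (intro sum.cong) (auto simp: grad_Phi_entry sum_distrib_left intro!: sum.cong)
  also have "\<dots> = (\<Sum>\<pi>\<in>?odd. A $$ (q, \<pi> p) * (\<Prod>k\<in>{0..<n} - {p}. A $$ (k, \<pi> k)))"
    by (rule sum.group[OF finite _ image]) simp
  finally show ?thesis .
qed

section \<open>Row replacement\<close>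

text \<open>Only the identity and the transposition of \<open>p\<close> and \<open>q\<close> contribute.\<close>

lemma det_one_mat_replace_two_rows:
  fixes u v :: "nat \<Rightarrow> 'a :: comm_ring_1"
  assumes "p < n" "q < n" "p \<noteq> q"
  shows "det (mat n n (\<lambda>(i, k). if i = p then u k else if i = q then v k
      else if i = k then 1 else 0)) = u p * v q - u q * v p"
    (is "det ?M = _")
proof -
  let ?f = "\<lambda>\<pi>. signof \<pi> * (\<Prod>i = 0..<n. ?M $$ (i, \<pi> i))"
  let ?t = "Transposition.transpose p q"
  have sub: "{p, q} \<subseteq> {0..<n}"
    using assms by auto
  have split: "(\<Prod>i = 0..<n. ?M $$ (i, \<pi> i)) =
      u (\<pi> p) * v (\<pi> q) * (\<Prod>i\<in>{0..<n} - {p, q}. if i = \<pi> i then 1 else 0)"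
    if "\<pi> permutes {0..<n}" for \<pi>
  proof -
    have less: "\<pi> i < n" if "i < n" for i
      using permutes_in_image[OF \<open>\<pi> permutes {0..<n}\<close>, of i] that by simp
    have "(\<Prod>i = 0..<n. ?M $$ (i, \<pi> i)) =
        (\<Prod>i\<in>{0..<n} - {p, q}. ?M $$ (i, \<pi> i)) * (\<Prod>i\<in>{p, q}. ?M $$ (i, \<pi> i))"
      by (rule prod.subset_diff[OF sub]) simp
    also have "(\<Prod>i\<in>{0..<n} - {p, q}. ?M $$ (i, \<pi> i)) =
        (\<Prod>i\<in>{0..<n} - {p, q}. if i = \<pi> i then 1 else 0)"
      by (rule prod.cong) (auto simp: less)
    also have "(\<Prod>i\<in>{p, q}. ?M $$ (i, \<pi> i)) = u (\<pi> p) * v (\<pi> q)"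
      using assms by (simp add: less)
    finally show ?thesis
      by (simp add: mult.commute)
  qed
  have "det ?M = (\<Sum>\<pi> | \<pi> permutes {0..<n}. ?f \<pi>)"
    by (rule det_def') simp
  also have "\<dots> = (\<Sum>\<pi>\<in>{id, ?t}. ?f \<pi>)"
  proof (rule sum.mono_neutral_right)
    show "{id, ?t} \<subseteq> {\<pi>. \<pi> permutes {0..<n}}"
      using assms by (auto intro: permutes_id permutes_swap_id)
    show "\<forall>\<pi>\<in>{\<pi>. \<pi> permutes {0..<n}} - {id, ?t}. ?f \<pi> = 0"
    proof
      fix \<pi> assume \<pi>: "\<pi> \<in> {\<pi>. \<pi> permutes {0..<n}} - {id, ?t}"
      \<comment> \<open>The identity and \<open>?t\<close> are the only permutations of
        \<open>{p, q}\<close>. Any other \<pi> moves some \<open>i\<close> outside this set, where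
        row \<open>i\<close> is a unit row with entry 0 in column \<open>\<pi> i\<close>.\<close>
      have "\<not> \<pi> permutes {p, q}"
        using \<pi> permutes_doubleton_iff[of \<pi> p q] by auto
      with \<pi> obtain i where "i \<in> {0..<n} - {p, q}" "\<pi> i \<noteq> i"
        using permutes_superset[of \<pi> "{0..<n}" "{p, q}"] by blast
      then have "(\<Prod>i\<in>{0..<n} - {p, q}. if i = \<pi> i then 1 else 0 :: 'a) = 0"
        by (intro prod_zero) (auto intro!: bexI[of _ i])
      moreover have "\<pi> permutes {0..<n}"
        using \<pi> by simp
      ultimately show "?f \<pi> = 0"
        by (simp only: split mult_zero_right)
    qed
  qed (simp add: finite_permutations)
  also have "\<dots> = ?f id + ?f ?t"
  proof -
    have "?t p \<noteq> id p"
      using assms by simp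
    then have "id \<noteq> ?t"
      by metis
    then show ?thesis
      by simp
  qed
  also have "?f id = u p * v q"
    by (subst split) (simp_all add: permutes_id sign_id)
  also have "?f ?t = - (u q * v p)"
    using assms by (subst split) (auto simp: permutes_swap_id sign_swap_id intro!: prod.neutral)
  finally show ?thesis
    by simp
qed

text \<open>Jacobi's identity for complementary minors of order \<open>n - 2\<close>. Multiplication
  by \<open>B\<close> on the right turns the untouched rows of \<open>A\<close> into unit rows and
  the two unit rows into rows \<open>a\<close> and \<open>b\<close> of \<open>B\<close>; since
  \<open>det B\<close> is inverse to \<open>det A\<close>, the determinant can be read off.\<close>

lemma det_replace_two_rows_by_units:
  fixes A B :: "'a :: comm_ring_1 mat"
  assumes A: "A \<in> carrier_mat n n" and B: "B \<in> carrier_mat n n"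
    and inv: "A * B = 1\<^sub>m n" "B * A = 1\<^sub>m n"
    and pq: "p < n" "q < n" "p \<noteq> q" and ab: "a < n" "b < n"
  shows "det (mat n n (\<lambda>(i, k). if i = p then of_bool (k = a) else if i = q then of_bool (k = b)
      else A $$ (i, k))) = det A * (B $$ (a, p) * B $$ (b, q) - B $$ (a, q) * B $$ (b, p))"
    (is "det ?M = _")
proof -
  have "?M * B = mat n n (\<lambda>(i, k). if i = p then B $$ (a, k) else if i = q then B $$ (b, k)
      else if i = k then 1 else 0)" (is "_ = ?N")
  proof (rule eq_matI)
    fix i k assume ik: "i < dim_row ?N" "k < dim_col ?N"
    then have entry: "(?M * B) $$ (i, k) = (\<Sum>j = 0..<n. ?M $$ (i, j) * B $$ (j, k))"
      using B by (simp add: scalar_prod_def)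
    have "(A * B) $$ (i, k) = (\<Sum>j = 0..<n. A $$ (i, j) * B $$ (j, k))"
      using ik A B by (simp add: scalar_prod_def)
    then have "(\<Sum>j = 0..<n. A $$ (i, j) * B $$ (j, k)) = (if i = k then 1 else 0)"
      using ik by (simp add: inv)
    moreover have "(\<Sum>j = 0..<n. ?M $$ (i, j) * B $$ (j, k)) =
        (\<Sum>j = 0..<n. (if i = p then of_bool (j = a) else if i = q then of_bool (j = b)
          else A $$ (i, j)) * B $$ (j, k))"
      using ik by (intro sum.cong) simp_all
    ultimately show "(?M * B) $$ (i, k) = ?N $$ (i, k)"
      unfolding entry using ik ab by (cases "i = p"; cases "i = q") simp_all
  qed (use B in simp_all)
  then have detMB: "det ?M * det B = B $$ (a, p) * B $$ (b, q) - B $$ (a, q) * B $$ (b, p)"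
    using det_mult[of ?M n B] B pq
      det_one_mat_replace_two_rows[of p n q "\<lambda>k. B $$ (a, k)" "\<lambda>k. B $$ (b, k)"]
    by simp
  have "det B * det A = 1"
    using det_mult[OF B A] by (simp add: inv)
  then have "det ?M = det ?M * det B * det A"
    by (simp add: mult.assoc)
  with detMB show ?thesis
    by (simp add: mult.commute)
qed

text \<open>In the Leibniz formula the two unit rows admit only permutations with
  \<open>\<pi> p = a\<close> and \<open>\<pi> q = b\<close>. This identifies the permutation sum
  with two prescribed values as a complementary minor.\<close>

lemma det_replace_two_rows_by_units_expand:
  fixes A :: "'a :: comm_ring_1 mat"
  assumes pq: "p < n" "q < n" "p \<noteq> q"
  shows "det (mat n n (\<lambda>(i, k). if i = p then of_bool (k = a) else if i = q then of_bool (k = b)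
      else A $$ (i, k))) =
    (\<Sum>\<pi> | \<pi> permutes {0..<n} \<and> \<pi> p = a \<and> \<pi> q = b.
      signof \<pi> * (\<Prod>k\<in>{0..<n} - {p, q}. A $$ (k, \<pi> k)))"
    (is "det ?M = _")
proof -
  let ?g = "\<lambda>\<pi>. signof \<pi> * (\<Prod>k\<in>{0..<n} - {p, q}. A $$ (k, \<pi> k))"
  have sub: "{p, q} \<subseteq> {0..<n}"
    using pq by auto
  have "det ?M = (\<Sum>\<pi> | \<pi> permutes {0..<n}. signof \<pi> * (\<Prod>i = 0..<n. ?M $$ (i, \<pi> i)))"
    by (rule det_def') simp
  also have "\<dots> = (\<Sum>\<pi> | \<pi> permutes {0..<n}. if \<pi> p = a \<and> \<pi> q = b then ?g \<pi> else 0)"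
  proof (rule sum.cong)
    fix \<pi> assume \<pi>: "\<pi> \<in> {\<pi>. \<pi> permutes {0..<n}}"
    have less: "\<pi> i < n" if "i < n" for i
      using permutes_in_image[of \<pi> "{0..<n}" i] \<pi> that by simp
    have "(\<Prod>i = 0..<n. ?M $$ (i, \<pi> i)) =
        (\<Prod>i\<in>{0..<n} - {p, q}. ?M $$ (i, \<pi> i)) * (\<Prod>i\<in>{p, q}. ?M $$ (i, \<pi> i))"
      by (rule prod.subset_diff[OF sub]) simp
    also have "(\<Prod>i\<in>{0..<n} - {p, q}. ?M $$ (i, \<pi> i)) =
        (\<Prod>i\<in>{0..<n} - {p, q}. A $$ (i, \<pi> i))"
      by (rule prod.cong) (auto simp: less)
    also have "(\<Prod>i\<in>{p, q}. ?M $$ (i, \<pi> i)) = of_bool (\<pi> p = a \<and> \<pi> q = b)"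
      using pq by (auto simp: less)
    finally show "signof \<pi> * (\<Prod>i = 0..<n. ?M $$ (i, \<pi> i)) =
        (if \<pi> p = a \<and> \<pi> q = b then ?g \<pi> else 0)"
      by simp
  qed simp
  also have "\<dots> = (\<Sum>\<pi> | \<pi> permutes {0..<n} \<and> \<pi> p = a \<and> \<pi> q = b. ?g \<pi>)"
    using sum.inter_filter[of "{\<pi>. \<pi> permutes {0..<n}}" ?g "\<lambda>\<pi>. \<pi> p = a \<and> \<pi> q = b"]
    by (simp add: finite_permutations)
  finally show ?thesis .
qed

text \<open>
  Composition with the transposition of \<open>p\<close> and \<open>q\<close> changes both the parity of \<open>\<pi>\<close> and the
  order of \<open>\<pi> p\<close> and \<open>\<pi> q\<close>.
\<close>

lemma sum_odd_eq_sum_less: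
  fixes w :: "(nat \<Rightarrow> nat) \<Rightarrow> 'a :: comm_monoid_add"
  assumes pq: "p < n" "q < n" "p \<noteq> q"
    and w: "\<And>\<pi>. \<pi> permutes {0..<n} \<Longrightarrow> w (\<pi> \<circ> Transposition.transpose p q) = w \<pi>"
  shows "(\<Sum>\<pi> | \<pi> permutes {0..<n} \<and> \<not> evenperm \<pi>. w \<pi>) =
    (\<Sum>\<pi> | \<pi> permutes {0..<n} \<and> \<pi> p < \<pi> q. w \<pi>)"
proof -
  let ?t = "Transposition.transpose p q"
  define S where "S e l = {\<pi>. \<pi> permutes {0..<n} \<and> evenperm \<pi> = e \<and> (\<pi> p < \<pi> q) = l}" for e l
  have finite: "finite (S e l)" for e l
    unfolding S_def by (simp add: finite_permutations)
  have swap: "\<pi> \<circ> ?t \<in> S (\<not> e) (\<not> l)" if "\<pi> \<in> S e l" for \<pi> e l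
  proof -
    have \<pi>: "\<pi> permutes {0..<n}"
      using that by (simp add: S_def)
    have t: "?t permutes {0..<n}"
      using pq by (simp add: permutes_swap_id)
    have "\<pi> p \<noteq> \<pi> q"
      using permutes_inj[OF \<pi>] pq by (auto dest: injD)
    moreover have "evenperm (\<pi> \<circ> ?t) \<longleftrightarrow> \<not> evenperm \<pi>"
      using evenperm_comp[of \<pi> ?t] permutes_imp_permutation[OF _ \<pi>] permutes_imp_permutation[OF _ t]
        pq by (simp add: evenperm_swap)
    ultimately show ?thesis
      using that permutes_compose[OF t \<pi>] by (auto simp: S_def)
  qed
  have "(\<Sum>\<pi> | \<pi> permutes {0..<n} \<and> \<not> evenperm \<pi>. w \<pi>) = sum w (S False True \<union> S False False)"
    by (rule sum.cong) (auto simp: S_def)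
  also have "\<dots> = sum w (S False True) + sum w (S False False)"
    by (rule sum.union_disjoint) (auto simp: finite, auto simp: S_def)
  \<comment> \<open>The odd permutations with \<open>\<pi> p > \<pi> q\<close> are traded for the
    even ones with \<open>\<pi> p < \<pi> q\<close>. Composition with \<open>?t\<close> is its own
    inverse, so it witnesses both directions.\<close>
  also have "sum w (S False False) = sum w (S True True)"
    by (rule sum.reindex_bij_witness[of _ "\<lambda>\<pi>. \<pi> \<circ> ?t" "\<lambda>\<pi>. \<pi> \<circ> ?t"])
      (use swap[of _ False False] swap[of _ True True] w in
        \<open>auto simp: comp_assoc S_def\<close>)
  also have "sum w (S False True) + sum w (S True True) = sum w (S False True \<union> S True True)"
    by (rule sum.union_disjoint[symmetric]) (auto simp: finite, auto simp: S_def)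
  also have "\<dots> = (\<Sum>\<pi> | \<pi> permutes {0..<n} \<and> \<pi> p < \<pi> q. w \<pi>)"
    by (rule sum.cong) (auto simp: S_def)
  finally show ?thesis .
qed

text \<open>The square of index pairs splits into two triangles and the diagonal, and swapping
  coordinates carries one triangle to the other. When the full double sum vanishes, the triangle sum
  is thus reduced to the diagonal.\<close>

lemma sum_less_add_sum_swap:
  fixes f :: "nat \<Rightarrow> nat \<Rightarrow> 'a :: comm_monoid_add"
  shows "(\<Sum>(a, b) | a < n \<and> b < n \<and> a < b. f a b + f b a) + (\<Sum>a<n. f a a) =
    (\<Sum>a<n. \<Sum>b<n. f a b)"
proof -
  let ?L = "{(a, b). a < n \<and> b < n \<and> a < b}"
  let ?G = "{(a, b). a < n \<and> b < n \<and> b < a}"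
  let ?E = "{(a, b). a < n \<and> b < n \<and> a = b}"
  let ?g = "\<lambda>(a, b). f a b"
  have fin: "finite {(a, b). a < n \<and> b < n \<and> P a b}" for P
    by (rule finite_subset[of _ "{..<n} \<times> {..<n}"]) auto
  have "(\<Sum>a<n. \<Sum>b<n. f a b) = sum ?g ({..<n} \<times> {..<n})"
    by (simp add: sum.cartesian_product)
  also have "{..<n} \<times> {..<n} = (?L \<union> ?G) \<union> ?E"
    by auto
  also have "sum ?g \<dots> = sum ?g (?L \<union> ?G) + sum ?g ?E"
    by (rule sum.union_disjoint) (auto simp: fin)
  also have "sum ?g (?L \<union> ?G) = sum ?g ?L + sum ?g ?G"
    by (rule sum.union_disjoint) (auto simp: fin)
  also have "sum ?g ?G = (\<Sum>(a, b)\<in>?L. f b a)"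
    by (rule sum.reindex_bij_witness[of _ prod.swap prod.swap]) auto
  also have "sum ?g ?E = (\<Sum>a<n. f a a)"
    by (rule sum.reindex_bij_witness[of _ "\<lambda>a. (a, a)" fst]) auto
  finally show ?thesis
    by (simp add: sum.distrib case_prod_unfold)
qed

section \<open>The gradient formula\<close>

lemma CHAR_2_uminus:
  fixes x :: "'a :: comm_ring_1"
  assumes "CHAR('a) = 2"
  shows "- x = x"
proof -
  have "(2 :: 'a) = 0"
    using of_nat_CHAR[where 'a = 'a] by (simp add: assms)
  then have "x + x = 0"
    by (metis mult_2 mult_zero_left)
  then show ?thesis
    by (simp add: minus_unique)
qed

lemma CHAR_2_add_self:
  fixes x :: "'a :: comm_ring_1"
  assumes "CHAR('a) = 2"
  shows "x + x = 0"
  by (metis CHAR_2_uminus[OF assms] add.right_inverse)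

section \<open>The product of \<open>A\<close> with its gradient matrix\<close>

lemma mult_grad_Phi_off_diagonal:
  fixes A B :: "'a :: comm_ring_1 mat"
  assumes char2: "CHAR('a) = 2"
    and A: "A \<in> carrier_mat n n" and B: "B \<in> carrier_mat n n"
    and inv: "A * B = 1\<^sub>m n" "B * A = 1\<^sub>m n"
    and pq: "p < n" "q < n" "p \<noteq> q"
  shows "(A * grad_Phi A) $$ (q, p) =
    det A * (\<Sum>a<n. (A $$ (q, a))\<^sup>2 * B $$ (a, q) * B $$ (a, p))"
proof -
  let ?t = "Transposition.transpose p q"
  let ?rest = "\<lambda>\<pi>. \<Prod>k\<in>{0..<n} - {p, q}. A $$ (k, \<pi> k)"
  let ?w = "\<lambda>\<pi>. A $$ (q, \<pi> p) * A $$ (q, \<pi> q) * ?rest \<pi>"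
  let ?f = "\<lambda>a b. (A $$ (q, a) * B $$ (a, p)) * (A $$ (q, b) * B $$ (b, q))"
  let ?less = "{\<pi>. \<pi> permutes {0..<n} \<and> \<pi> p < \<pi> q}"
  let ?L = "{(a, b). a < n \<and> b < n \<and> a < b}"
  note uminus = CHAR_2_uminus[OF char2]
  \<comment> \<open>Signs disappear, so an unsigned permutation sum can be read as a
    determinant.\<close>
  have sign: "(signof \<pi> :: 'a) = 1" for \<pi> :: "nat \<Rightarrow> nat"
    by (simp add: sign_def uminus)
  have minus: "x - y = x + y" for x y :: 'a
    by (metis diff_conv_add_uminus uminus)
  have row: "(\<Sum>a<n. A $$ (q, a) * B $$ (a, k)) = of_bool (k = q)" if "k < n" for k
  proof -
    have "(A * B) $$ (q, k) = (\<Sum>a<n. A $$ (q, a) * B $$ (a, k))"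
      using A B pq that by (simp add: scalar_prod_def atLeast0LessThan)
    then show ?thesis
      using that pq by (auto simp: inv)
  qed
  have "(A * grad_Phi A) $$ (q, p) = (\<Sum>\<pi> | \<pi> permutes {0..<n} \<and> \<not> evenperm \<pi>. ?w \<pi>)"
  proof -
    have set: "{0..<n} - {p} - {q} = {0..<n} - {p, q}"
      by auto
    have "(\<Prod>k\<in>{0..<n} - {p}. A $$ (k, \<pi> k)) = A $$ (q, \<pi> q) * ?rest \<pi>" for \<pi>
      using pq by (subst prod.remove[of _ q]) (auto simp: set)
    then show ?thesis
      using A pq by (simp add: mult_grad_Phi_entry mult.assoc)
  qed
  \<comment> \<open>Row \<open>q\<close> of \<open>A\<close> serves both row \<open>p\<close> and
    row \<open>q\<close>, so exchanging the values \<open>\<pi> p\<close> and \<open>\<pi> q\<close>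
    preserves the weight.\<close>
  also have "\<dots> = (\<Sum>\<pi>\<in>?less. ?w \<pi>)"
  proof (rule sum_odd_eq_sum_less[OF pq])
    fix \<pi> :: "nat \<Rightarrow> nat"
    have "?rest (\<pi> \<circ> ?t) = ?rest \<pi>"
      by (rule prod.cong) auto
    then show "?w (\<pi> \<circ> ?t) = ?w \<pi>"
      by (simp add: mult.commute)
  qed
  also have "\<dots> = (\<Sum>c\<in>?L. \<Sum>\<pi>\<in>{\<pi> \<in> ?less. (\<pi> p, \<pi> q) = c}. ?w \<pi>)"
  proof (rule sum.group[symmetric])
    show "finite ?less"
      by (simp add: finite_permutations)
    show "finite ?L"
      by (rule finite_subset[of _ "{..<n} \<times> {..<n}"]) auto
    show "(\<lambda>\<pi>. (\<pi> p, \<pi> q)) ` ?less \<subseteq> ?L"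
      using pq by (auto dest: permutes_in_image[of _ _ p] permutes_in_image[of _ _ q])
  qed
  \<comment> \<open>For fixed values \<open>a < b\<close> the condition
    \<open>\<pi> p < \<pi> q\<close> is automatic, and the products over the remaining rows add up
    to a complementary minor. Its difference of two products is also their sum.\<close>
  also have "\<dots> = (\<Sum>(a, b)\<in>?L. det A * (?f a b + ?f b a))"
  proof (rule sum.cong)
    fix c assume "c \<in> ?L"
    then obtain a b where c: "c = (a, b)" and ab: "a < n" "b < n" "a < b"
      by auto
    have "{\<pi> \<in> ?less. (\<pi> p, \<pi> q) = c} = {\<pi>. \<pi> permutes {0..<n} \<and> \<pi> p = a \<and> \<pi> q = b}"
      using ab by (auto simp: c)
    then have "(\<Sum>\<pi>\<in>{\<pi> \<in> ?less. (\<pi> p, \<pi> q) = c}. ?w \<pi>) =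
        A $$ (q, a) * A $$ (q, b) *
          (\<Sum>\<pi> | \<pi> permutes {0..<n} \<and> \<pi> p = a \<and> \<pi> q = b. signof \<pi> * ?rest \<pi>)"
      unfolding sum_distrib_left by (intro sum.cong) (simp_all add: sign)
    also have "\<dots> = A $$ (q, a) * A $$ (q, b) *
        (det A * (B $$ (a, p) * B $$ (b, q) - B $$ (a, q) * B $$ (b, p)))"
      by (simp only: det_replace_two_rows_by_units_expand[OF pq, symmetric]
          det_replace_two_rows_by_units[OF A B inv pq ab(1,2)])
    finally show "(\<Sum>\<pi>\<in>{\<pi> \<in> ?less. (\<pi> p, \<pi> q) = c}. ?w \<pi>) =
        (case c of (a, b) \<Rightarrow> det A * (?f a b + ?f b a))"
      unfolding minus by (simp add: c algebra_simps)
  qed simp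
  also have "\<dots> = det A * (\<Sum>(a, b)\<in>?L. ?f a b + ?f b a)"
    by (simp add: sum_distrib_left case_prod_unfold)
  also have "(\<Sum>(a, b)\<in>?L. ?f a b + ?f b a) = (\<Sum>a<n. ?f a a)"
  proof -
    \<comment> \<open>The double sum factors into the entries \<open>(q, p)\<close> and
      \<open>(q, q)\<close> of \<open>A * B\<close>, which are 0 and 1.\<close>
    have "(\<Sum>a<n. \<Sum>b<n. ?f a b) = 0"
      using pq by (simp add: sum_product[symmetric] row)
    then have "(\<Sum>(a, b)\<in>?L. ?f a b + ?f b a) = - (\<Sum>a<n. ?f a a)"
      using sum_less_add_sum_swap[of ?f n] by (simp add: eq_neg_iff_add_eq_0)
    then show ?thesis
      by (simp only: uminus)
  qed
  finally show ?thesis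
    by (simp add: power2_eq_square algebra_simps)
qed

text \<open>Replacing row \<open>p\<close> by itself leaves \<open>A\<close> unchanged: the extra
  factor restores the full product of each term.\<close>

lemma mult_grad_Phi_diagonal:
  assumes A: "A \<in> carrier_mat n n" and p: "p < n"
  shows "(A * grad_Phi A) $$ (p, p) = Phi A"
proof -
  have "A $$ (p, \<pi> p) * (\<Prod>k\<in>{0..<n} - {p}. A $$ (k, \<pi> k)) = (\<Prod>k = 0..<n. A $$ (k, \<pi> k))" for \<pi>
    using p by (simp add: prod.remove[of "{0..<n}" p])
  then show ?thesis
    using A p by (simp add: mult_grad_Phi_entry Phi_def)
qed

text \<open>The cross terms of a square carry the factor 2. For infinite \<open>I\<close> both sums
  are 0 by convention.\<close>

lemma CHAR_2_sum_power2:
  fixes f :: "'b \<Rightarrow> 'a :: comm_ring_1"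
  assumes "CHAR('a) = 2"
  shows "(\<Sum>i\<in>I. (f i)\<^sup>2) = (\<Sum>i\<in>I. f i)\<^sup>2"
proof -
  have "2 * x = (0 :: 'a)" for x
    unfolding mult_2 by (rule CHAR_2_add_self[OF assms])
  then show ?thesis
    by (induction I rule: infinite_finite_induct) (simp_all add: power2_sum mult.assoc)
qed

lemma mult_grad_Phi:
  fixes A B C :: "'a :: comm_ring_1 mat"
  assumes char2: "CHAR('a) = 2"
    and A: "A \<in> carrier_mat n n" and B: "B \<in> carrier_mat n n"
    and inv: "A * B = 1\<^sub>m n" "B * A = 1\<^sub>m n"
    and C: "C = mat n n (\<lambda>(p, j). (A $$ (p, j))\<^sup>2 * B $$ (j, p))"
  shows "A * grad_Phi A = det A \<cdot>\<^sub>m (C * B) + (Phi A + det A) \<cdot>\<^sub>m 1\<^sub>m n" (is "?L = ?R")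
proof (rule eq_matI)
  fix q p assume "q < dim_row ?R" "p < dim_col ?R"
  then have q: "q < n" and p: "p < n"
    by simp_all
  have CB: "(C * B) $$ (q, p) = (\<Sum>a<n. (A $$ (q, a))\<^sup>2 * B $$ (a, q) * B $$ (a, p))"
    using q p B by (simp add: C scalar_prod_def atLeast0LessThan)
  have dim: "dim_row C = n" "dim_col B = n"
    using B by (simp_all add: C)
  show "?L $$ (q, p) = ?R $$ (q, p)"
  proof (cases "p = q")
    case True
    have "(\<Sum>a<n. A $$ (q, a) * B $$ (a, q)) = (A * B) $$ (q, q)"
      using A B q by (simp add: scalar_prod_def atLeast0LessThan)
    then have "(\<Sum>a<n. A $$ (q, a) * B $$ (a, q)) = 1"
      using q by (simp add: inv)
    \<comment> \<open>By additivity of squaring, this entry is the square of the entry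
      \<open>(q, q)\<close> of \<open>A * B\<close>.\<close>
    then have "(C * B) $$ (q, q) = 1"
      using CHAR_2_sum_power2[OF char2, of "\<lambda>a. A $$ (q, a) * B $$ (a, q)" "{..<n}"] CB True
      by (simp add: power2_eq_square mult_ac)
    \<comment> \<open>The contribution \<open>det A\<close> of \<open>C * B\<close> on the diagonal
      cancels the \<open>det A\<close> in the scalar matrix.\<close>
    moreover have "det A + (Phi A + det A) = Phi A"
      by (metis CHAR_2_add_self[OF char2] add.commute add.left_commute add.right_neutral)
    ultimately show ?thesis
      using A q True by (simp add: mult_grad_Phi_diagonal dim del: index_mult_mat(1))
  next
    case False
    then show ?thesis
      using mult_grad_Phi_off_diagonal[OF char2 A B inv p q] CB p q
      by (simp add: dim del: index_mult_mat(1))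
  qed
qed (use A B in \<open>simp_all add: grad_Phi_def\<close>)

text \<open>Left multiplication by \<open>B\<close> removes the factor \<open>A\<close> from the
  formula for \<open>A * grad_Phi A\<close>.\<close>

lemma grad_Phi_eq:
  fixes A B C :: "'a :: comm_ring_1 mat"
  assumes char2: "CHAR('a) = 2"
    and A: "A \<in> carrier_mat n n" and B: "B \<in> carrier_mat n n"
    and inv: "A * B = 1\<^sub>m n" "B * A = 1\<^sub>m n"
    and C: "C = mat n n (\<lambda>(p, j). (A $$ (p, j))\<^sup>2 * B $$ (j, p))"
  shows "grad_Phi A = det A \<cdot>\<^sub>m (B * C * B) + (Phi A + det A) \<cdot>\<^sub>m B"
proof -
  have C': "C \<in> carrier_mat n n"
    by (simp add: C)
  have G: "grad_Phi A \<in> carrier_mat n n"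
    using A by (simp add: grad_Phi_def)
  have "grad_Phi A = B * (A * grad_Phi A)"
    using G assoc_mult_mat[OF B A G] by (simp add: inv)
  also have "\<dots> = B * (det A \<cdot>\<^sub>m (C * B)) + B * ((Phi A + det A) \<cdot>\<^sub>m 1\<^sub>m n)"
    unfolding mult_grad_Phi[OF assms] by (rule mult_add_distrib_mat[OF B]) (use B C' in auto)
  also have "B * (det A \<cdot>\<^sub>m (C * B)) = det A \<cdot>\<^sub>m (B * C * B)"
    using B C' by (simp add: mult_smult_distrib[of _ n n _ n] assoc_mult_mat[of _ n n _ n _ n])
  also have "B * ((Phi A + det A) \<cdot>\<^sub>m 1\<^sub>m n) = (Phi A + det A) \<cdot>\<^sub>m B"
    using B by (simp add: mult_smult_distrib[of _ n n _ n])
  finally show ?thesis .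
qed

section \<open>The program\<close>

text \<open>Flattens a nested loop into one pass over a list of cells, so that its effect can be
  proved by induction on an arbitrary list.\<close>

lemma concat_loops: "concat [f i j. i \<leftarrow> xs, j \<leftarrow> ys] = concat (map (\<lambda>(i, j). f i j) (List.product xs ys))"
  by (induction xs) (simp_all add: comp_def)

lemma run_append: "run n (P @ Q) s = run n Q (run n P s)"
  by (simp add: run_def)

lemma run_Cons: "run n (c # P) s = run n P (exec n c s)"
  by (simp add: run_def)

lemma run_Nil [simp]: "run n [] s = s"
  by (simp add: run_def)

text \<open>Each round overwrites its cell of \<open>ArrC\<close> before reading it and otherwise
  reads only inputs; a repeated cell is therefore recomputed to the same value.\<close>

lemma run_loop_C:
  "run n (concat (map (\<lambda>(p, j). [Mul (ArrC, p, j) (InA, p, j) (InA, p, j),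
      Mul (ArrC, p, j) (ArrC, p, j) (InB, j, p)]) cells)) s =
    (\<lambda>(X, p, j). if X = ArrC \<and> (p, j) \<in> set cells then (s (InA, p, j))\<^sup>2 * s (InB, j, p)
      else s (X, p, j))"
  by (induction cells arbitrary: s)
    (auto simp: run_append run_Cons fun_eq_iff power2_eq_square split: prod.splits)

text \<open>Each round rescales the old value of its cell in \<open>Out\<close>, so a repeated cell
  would be scaled twice; hence the distinctness. \<open>ArrT\<close> now serves as scratch
  space.\<close>

lemma run_loop_Out:
  assumes "distinct cells"
  shows "run n (concat (map (\<lambda>(i, j). [Mul (Out, i, j) (InDelta, 0, 0) (Out, i, j),
      Mul (ArrT, i, j) (ArrS, 0, 0) (InB, i, j),
      Add (Out, i, j) (Out, i, j) (ArrT, i, j)]) cells)) s (Out, p, q) =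
    (if (p, q) \<in> set cells
     then s (InDelta, 0, 0) * s (Out, p, q) + s (ArrS, 0, 0) * s (InB, p, q)
     else s (Out, p, q))"
  using assms
  by (induction cells arbitrary: s) (auto simp: run_append run_Cons)

lemma stored_mat_exec_MatMul:
  "stored_mat n (exec n (MatMul Z X Y) s) V =
    (if V = Z then stored_mat n s X * stored_mat n s Y else stored_mat n s V)"
  by (rule eq_matI) (auto simp: stored_mat_def)

lemma stored_mat_grad_program:
  fixes s :: "arr reg \<Rightarrow> 'a :: comm_ring_1" and n :: nat
  defines "A \<equiv> stored_mat n s InA" and "B \<equiv> stored_mat n s InB"
  defines "C \<equiv> mat n n (\<lambda>(p, j). (A $$ (p, j))\<^sup>2 * B $$ (j, p))"
  shows "stored_mat n (run n (grad_program n) s) Out =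
    s (InDelta, 0, 0) \<cdot>\<^sub>m (B * C * B) + (s (InF, 0, 0) + s (InDelta, 0, 0)) \<cdot>\<^sub>m B"
proof -
  let ?cells = "List.product [0..<n] [0..<n]"
  \<comment> \<open>The states \<open>s1\<close>, \<open>s2\<close> and \<open>s3\<close> follow the
    loop for \<open>C\<close>, the two matrix multiplications, and the addition of \<open>F\<close>
    and \<Delta>, respectively.\<close>
  define s1 where "s1 = run n (concat (map (\<lambda>(p, j). [Mul (ArrC, p, j) (InA, p, j) (InA, p, j),
      Mul (ArrC, p, j) (ArrC, p, j) (InB, j, p)]) ?cells)) s"
  define s2 where "s2 = exec n (MatMul Out ArrT InB) (exec n (MatMul ArrT InB ArrC) s1)"
  define s3 where "s3 = exec n (Add (ArrS, 0, 0) (InF, 0, 0) (InDelta, 0, 0)) s2"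
  have "stored_mat n s1 ArrC = C"
    by (rule eq_matI) (auto simp: s1_def run_loop_C C_def A_def B_def stored_mat_def)
  moreover have "stored_mat n s1 InB = B"
    by (rule eq_matI) (auto simp: s1_def run_loop_C B_def stored_mat_def)
  ultimately have Out: "stored_mat n s2 Out = B * C * B"
    by (simp add: s2_def stored_mat_exec_MatMul del: exec.simps)
  \<comment> \<open>These inputs are read again later and must have survived the first three
    parts.\<close>
  have s2: "s2 (InDelta, i, j) = s (InDelta, i, j)" "s2 (InF, i, j) = s (InF, i, j)"
    "s2 (InB, i, j) = s (InB, i, j)" for i j
    by (simp_all add: s2_def s1_def run_loop_C)
  have Out': "s2 (Out, i, j) = (B * C * B) $$ (i, j)" if "i < n" "j < n" for i j
    using that by (simp flip: Out add: stored_mat_def del: index_mult_mat(1))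
  have run: "run n (grad_program n) s = run n (concat (map (\<lambda>(i, j).
      [Mul (Out, i, j) (InDelta, 0, 0) (Out, i, j), Mul (ArrT, i, j) (ArrS, 0, 0) (InB, i, j),
       Add (Out, i, j) (Out, i, j) (ArrT, i, j)]) ?cells)) s3"
    unfolding grad_program_def concat_loops run_append run_Cons run_Nil s1_def s2_def s3_def ..
  have dim: "dim_row B = n" "dim_col B = n"
    by (simp_all add: B_def stored_mat_def)
  have B_entry: "B $$ (i, j) = s (InB, i, j)" if "i < n" "j < n" for i j
    using that by (simp add: B_def stored_mat_def)
  show ?thesis
    unfolding run
    by (rule eq_matI) (simp_all add: stored_mat_def run_loop_Out distinct_product
        s3_def s2 Out' dim B_entry
        del: index_mult_mat(1))
qed

section \<open>Operation counts\<close>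

lemma matmul_count_simps [simp]:
  "matmul_count [] = 0"
  "matmul_count (c # P) = (if is_MatMul c then 1 else 0) + matmul_count P"
  "matmul_count (P @ Q) = matmul_count P + matmul_count Q"
  by (simp_all add: matmul_count_def)

lemma ring_op_count_simps [simp]:
  "ring_op_count [] = 0"
  "ring_op_count (c # P) = (if is_MatMul c then 0 else 1) + ring_op_count P"
  "ring_op_count (P @ Q) = ring_op_count P + ring_op_count Q"
  by (simp_all add: ring_op_count_def)

lemma matmul_count_concat: "matmul_count (concat Ps) = sum_list (map matmul_count Ps)"
  by (induction Ps) simp_all

lemma ring_op_count_concat: "ring_op_count (concat Ps) = sum_list (map ring_op_count Ps)"
  by (induction Ps) simp_all

lemma matmul_count_grad_program: "matmul_count (grad_program n) = 2"
  unfolding grad_program_def concat_loops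
  by (simp add: matmul_count_concat comp_def case_prod_unfold)

text \<open>Each cell costs two operations in the loop for \<open>C\<close> and three in the final
  loop; the single extra one forms \<open>F + \<Delta>\<close>.\<close>

lemma ring_op_count_grad_program: "ring_op_count (grad_program n) = 5 * n\<^sup>2 + 1"
  unfolding grad_program_def concat_loops
  by (simp add: ring_op_count_concat comp_def case_prod_unfold sum_list_triv power2_eq_square)

lemma ring_op_count_grad_program_bigo:
  "(\<lambda>n. real (ring_op_count (grad_program n))) \<in> O(\<lambda>n. real n ^ 2)"
proof (rule bigoI)
  \<comment> \<open>The constant is 5 + 1: for \<open>n \<ge> 1\<close> the single extra operation
    is absorbed by another \<open>n^2\<close>.\<close>
  show "\<forall>\<^sub>F n in sequentially. norm (real (ring_op_count (grad_program n))) \<le> 6 * norm (real n ^ 2)"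
    using eventually_ge_at_top[of 1]
  proof eventually_elim
    case (elim n)
    then have "1 \<le> real n ^ 2"
      by simp
    then show ?case
      by (simp add: ring_op_count_grad_program)
  qed
qed

theorem proposition5p2:
  fixes A B C :: "'a :: comm_ring_1 mat" and F \<Delta> :: 'a and n :: nat
  assumes char2: "CHAR('a) = 2"
    and A: "A \<in> carrier_mat n n"
    and B: "B \<in> carrier_mat n n"
    and inverse: "inverts_mat A B" "inverts_mat B A"
    and Delta: "\<Delta> = det A"
    and F: "F = Phi A"
    and C: "C = mat n n (\<lambda>(p, j). (A $$ (p, j))\<^sup>2 * B $$ (j, p))"
  shows "grad_Phi A = \<Delta> \<cdot>\<^sub>m (B * C * B) + (F + \<Delta>) \<cdot>\<^sub>m B
    \<and> (\<forall>s. stored_mat n s InA = A \<and> stored_mat n s InB = B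
            \<and> s (InF, 0, 0) = F \<and> s (InDelta, 0, 0) = \<Delta>
          \<longrightarrow> stored_mat n (run n (grad_program n) s) Out = grad_Phi A)
    \<and> (\<forall>m. matmul_count (grad_program m) = 2)
    \<and> (\<lambda>m. real (ring_op_count (grad_program m))) \<in> O(\<lambda>m. real m ^ 2)"
proof -
  have "A * B = 1\<^sub>m n" "B * A = 1\<^sub>m n"
    using inverse A B by (simp_all add: inverts_mat_def)
  then have grad: "grad_Phi A = \<Delta> \<cdot>\<^sub>m (B * C * B) + (F + \<Delta>) \<cdot>\<^sub>m B"
    unfolding Delta F by (rule grad_Phi_eq[OF char2 A B _ _ C])
  moreover have "stored_mat n (run n (grad_program n) s) Out = grad_Phi A"
    if "stored_mat n s InA = A \<and> stored_mat n s InB = B \<and> s (InF, 0, 0) = F \<and> s (InDelta, 0, 0) = \<Delta>"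
    for s
    using that by (simp add: stored_mat_grad_program grad C)
  ultimately show ?thesis
    using matmul_count_grad_program ring_op_count_grad_program_bigo by blast
qed

end
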